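(* Let $H$ be a fixed non-matching graph with $e(H)\ge 3$. For every fixed integer $\ell\ge e(H)$, $$\lambda(H,\ell)\ge \max_{1\le j\le e(H)-1}\bigl(\pi_j(H)\log\ell+(1-\pi_j(H))\log j\bigr)$$ and $$\lambda(H,\ell)\le \pi_-(H)\log\ell+\bigl(1-\pi_-(H)\bigr)\log(e(H)-1).$$ Consequently, $$\lim_{\ell\to\infty}\frac{\lambda(H,\ell)}{\log\ell}=\pi_-(H).$$ Moreover, $\lambda(H,\ell)=\log(e(H)-1)$ for every integer $\ell\ge e(H)$ if and only if $H-e$ is bipartite for some $e\in E(H)$.
   Context: All graphs are finite and simple; $v(G)$, $e(G)$ denote numbers of vertices and edges. $H$ has no isolated vertices (isolated vertices play no role and are deleted). $H$ is non-matching if it contains two adjacent edges. Logarithms are natural. $[s]=\{1,\dots,s\}$. Copies of graphs are not required to be induced. For $S\subseteq E(H)$, $H-S$ is the spanning subgraph of $H$ obtained by deleting the edges in $S$, and $H-e=H-\{e\}$. For $1\le j\le e(H)-1$ let $\chi_j(H)=\min\{\chi(H-S):S\subseteq E(H),|S|=j\}$, where $\chi$ is the chromatic number, and let $$\pi_j(H)=\begin{cases}1-\dfrac{1}{\chi_j(H)-1},&\chi_j(H)\ge 3,\\ 0,&\chi_j(H)\le 2.\end{cases}$$ Write $\pi_-(H)=\pi_1(H)$. An $\ell$-palette template on $K_n$ is a map $\mathcal P:E(K_n)\to 2^{[\ell]}\setminus\{\emptyset\}$. A finite family of sets $A_1,\dots,A_q$ has a system of distinct representatives (SDR) if there are pairwise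 distinct $a_i\in A_i$. The template $\mathcal P$ is $H$-SDR-free if on every copy of $H$ in $K_n$ the palettes assigned to its edges have no SDR. Let $\operatorname{ex}_{\log}(n;H,\ell)$ be the maximum of $\sum_{e\in E(K_n)}\log|\mathcal P(e)|$ over all $H$-SDR-free $\ell$-palette templates $\mathcal P$ on $K_n$, and define $$\lambda(H,\ell)=\inf_{n\ge v(H)}\frac{\operatorname{ex}_{\log}(n;H,\ell)}{\binom n2}.$$ *)

theory Defs
  imports Complex_Main "HOL-Library.FuncSet"
begin

type_synonym 'a graph = "'a set \<times> 'a set set"

abbreviation verts :: "'a graph \<Rightarrow> 'a set" where
  "verts G \<equiv> fst G"

abbreviation edges :: "'a graph \<Rightarrow> 'a set set" where
  "edges G \<equiv> snd G"

definition all_edges :: "'a set \<Rightarrow> 'a set set" where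
  "all_edges V = {e. e \<subseteq> V \<and> card e = 2}"

definition simple_graph :: "'a graph \<Rightarrow> bool" where
  "simple_graph G \<longleftrightarrow> finite (verts G) \<and> edges G \<subseteq> all_edges (verts G)"

definition no_isolated_verts :: "'a graph \<Rightarrow> bool" where
  "no_isolated_verts G \<longleftrightarrow> (\<forall>v\<in>verts G. \<exists>e\<in>edges G. v \<in> e)"

definition non_matching :: "'a graph \<Rightarrow> bool" where
  "non_matching G \<longleftrightarrow> (\<exists>e\<in>edges G. \<exists>e'\<in>edges G. e \<noteq> e' \<and> e \<inter> e' \<noteq> {})"

definition complete_graph :: "nat \<Rightarrow> nat graph" where
  "complete_graph n = ({1..n}, all_edges {1..n})"

definition del_edges :: "'a graph \<Rightarrow> 'a set set \<Rightarrow> 'a graph" where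
  "del_edges G S = (verts G, edges G - S)"

definition proper_colouring :: "'a graph \<Rightarrow> nat \<Rightarrow> ('a \<Rightarrow> nat) \<Rightarrow> bool" where
  "proper_colouring G k c \<longleftrightarrow>
     c \<in> verts G \<rightarrow> {..<k} \<and>
     (\<forall>u\<in>verts G. \<forall>v\<in>verts G. {u, v} \<in> edges G \<longrightarrow> c u \<noteq> c v)"

definition chromatic_number :: "'a graph \<Rightarrow> nat" where
  "chromatic_number G = (LEAST k. \<exists>c. proper_colouring G k c)"

definition bipartite :: "'a graph \<Rightarrow> bool" where
  "bipartite G \<longleftrightarrow>
     (\<exists>A B. A \<union> B = verts G \<and> A \<inter> B = {} \<and>
        (\<forall>e\<in>edges G. \<exists>a\<in>A. \<exists>b\<in>B. e = {a, b}))"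

definition chi_del :: "'a graph \<Rightarrow> nat \<Rightarrow> nat" where
  "chi_del H j = Min {chromatic_number (del_edges H S) | S. S \<subseteq> edges H \<and> card S = j}"

definition pi_del :: "'a graph \<Rightarrow> nat \<Rightarrow> real" where
  "pi_del H j = (if chi_del H j \<ge> 3 then 1 - 1 / (real (chi_del H j) - 1) else 0)"

abbreviation pi_minus :: "'a graph \<Rightarrow> real" where
  "pi_minus H \<equiv> pi_del H 1"

text \<open>The subgraph \<open>F\<close> of \<open>G\<close> (not necessarily induced) is a copy of \<open>H\<close>.\<close>

definition copy_in :: "'a graph \<Rightarrow> 'b graph \<Rightarrow> 'b graph \<Rightarrow> bool" where
  "copy_in H F G \<longleftrightarrow>
     verts F \<subseteq> verts G \<and> edges F \<subseteq> edges G \<and>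
     (\<exists>f. bij_betw f (verts H) (verts F) \<and> edges F = (\<lambda>e. f ` e) ` edges H)"

definition has_sdr :: "'i set \<Rightarrow> ('i \<Rightarrow> 'c set) \<Rightarrow> bool" where
  "has_sdr I A \<longleftrightarrow> (\<exists>a. (\<forall>i\<in>I. a i \<in> A i) \<and> inj_on a I)"

text \<open>Templates are extensional functions, i.e. \<open>undefined\<close> outside the edges of \<open>K_n\<close>;
  hence there are only finitely many.\<close>

definition palette_templates :: "nat \<Rightarrow> nat \<Rightarrow> (nat set \<Rightarrow> nat set) set" where
  "palette_templates n l = edges (complete_graph n) \<rightarrow>\<^sub>E (Pow {1..l} - {{}})"

definition sdr_free :: "'a graph \<Rightarrow> nat \<Rightarrow> (nat set \<Rightarrow> nat set) \<Rightarrow> bool" where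
  "sdr_free H n P \<longleftrightarrow> (\<forall>F. copy_in H F (complete_graph n) \<longrightarrow> \<not> has_sdr (edges F) P)"

definition ex_log :: "nat \<Rightarrow> 'a graph \<Rightarrow> nat \<Rightarrow> real" where
  "ex_log n H l =
     Max {\<Sum>e\<in>edges (complete_graph n). ln (real (card (P e))) | P.
            P \<in> palette_templates n l \<and> sdr_free H n P}"

definition sdr_lambda :: "'a graph \<Rightarrow> nat \<Rightarrow> real" where
  "sdr_lambda H l = (INF n\<in>{card (verts H)..}. ex_log n H l / real (n choose 2))"

end

theory Submission
  imports Defs
begin

text \<open>Lower bound: put \<open>r = max (\<chi>\<^sub>j(H)) 2 - 1\<close>, split the vertices of \<open>K\<^sub>n\<close> into \<open>r\<close> parts with at
  most a \<open>1/r\<close> fraction of the pairs inside a part, give the palette \<open>[j]\<close> to the inside pairs and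
  \<open>[\<ell>]\<close> to the others. Deleting from a copy of \<open>H\<close> its inside edges leaves an \<open>r\<close>-colourable graph,
  so there are more than \<open>j\<close> of them and their palettes have no SDR.

  Upper bound: if the edges with palettes of size at least \<open>e(H)\<close> contained a copy of some \<open>H - e\<close>,
  then a representative chosen for \<open>e\<close> would extend greedily to an SDR. By the Erdos--Stone theorem
  these edges therefore have density at most \<open>\<pi>\<^sub>-(H) + o(1)\<close>, and all other palettes have at most
  \<open>e(H) - 1\<close> elements. Erdos--Stone is proved by deleting vertices of small degree and then
  enlarging a complete multipartite graph one part at a time.\<close>

section \<open>The Erdos--Stone theorem\<close>

lemma real_choose_two: "real (n choose 2) = real n * (real n - 1) / 2"
  by (induction n) (simp_all add: numeral_2_eq_2 field_simps)

lemma card_all_edges: "finite V \<Longrightarrow> card (all_edges V) = card V choose 2"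
  unfolding all_edges_def by (rule n_subsets)

lemma finite_all_edges: "finite V \<Longrightarrow> finite (all_edges V)"
  unfolding all_edges_def by simp

lemma all_edges_insert:
  assumes "v \<notin> V"
  shows "all_edges (insert v V) = all_edges V \<union> (\<lambda>w. {v, w}) ` V"
proof (intro set_eqI iffI)
  fix e assume "e \<in> all_edges (insert v V)"
  then show "e \<in> all_edges V \<union> (\<lambda>w. {v, w}) ` V"
    unfolding all_edges_def card_2_iff by (auto simp: doubleton_eq_iff insert_commute)
next
  fix e assume "e \<in> all_edges V \<union> (\<lambda>w. {v, w}) ` V"
  then show "e \<in> all_edges (insert v V)"
    using assms unfolding all_edges_def by (auto simp: card_insert_if)
qed

lemma card_edges_insert:
  assumes "finite V" "v \<notin> V"
  shows "card (G \<inter> all_edges (insert v V))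
           = card (G \<inter> all_edges V) + card {w \<in> V. {v, w} \<in> G}"
proof -
  let ?N = "{w \<in> V. {v, w} \<in> G}"
  have "G \<inter> all_edges (insert v V) = (G \<inter> all_edges V) \<union> (\<lambda>w. {v, w}) ` ?N"
    unfolding all_edges_insert[OF assms(2)] by auto
  moreover have "(G \<inter> all_edges V) \<inter> (\<lambda>w. {v, w}) ` ?N = {}"
    using assms(2) by (auto simp: all_edges_def)
  moreover have "inj_on (\<lambda>w. {v, w}) ?N"
    by (auto simp: inj_on_def doubleton_eq_iff)
  ultimately show ?thesis
    using assms(1) by (simp add: card_Un_disjoint finite_all_edges card_image)
qed

text \<open>Remove vertices of small degree one at a time while at least \<open>n0\<close> vertices
  remain. The removed degrees add up to at most \<open>c\<close> times the sum of the orders passed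
  through, hence to at most \<open>c\<close> times 1 + 2 + ... + \<open>card V\<close>, which is
  \<open>(card V choose 2) + card V\<close>. What remains spans at most \<open>n0 choose 2\<close>
  edges.\<close>

lemma degenerate_edge_bound:
  fixes c :: real
  assumes "finite V" and "0 \<le> c"
    and "\<And>W. W \<subseteq> V \<Longrightarrow> W \<noteq> {} \<Longrightarrow> n0 \<le> card W \<Longrightarrow>
           \<exists>v\<in>W. real (card {w \<in> W. {v, w} \<in> G}) \<le> c * real (card W)"
  shows "real (card (G \<inter> all_edges V))
           \<le> c * real ((card V choose 2) + card V) + real (n0 choose 2)"
  using assms(1,3)
proof (induction "card V" arbitrary: V rule: less_induct)
  case less
  show ?case
  proof (cases "V \<noteq> {} \<and> n0 \<le> card V")
    case False
    then have "card V \<le> n0" by auto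
    have "card (G \<inter> all_edges V) \<le> card V choose 2"
      using card_mono[OF finite_all_edges[OF less.prems(1)], of "G \<inter> all_edges V"]
        card_all_edges[OF less.prems(1)] by simp
    also have "\<dots> \<le> n0 choose 2"
      using \<open>card V \<le> n0\<close> by (rule binomial_right_mono)
    finally show ?thesis using assms(2)
      by (smt (verit) mult_nonneg_nonneg of_nat_0_le_iff of_nat_mono)
  next
    case True
    then obtain v where v: "v \<in> V" and dv: "real (card {w \<in> V. {v, w} \<in> G}) \<le> c * real (card V)"
      using less.prems(2)[of V] by auto
    define W where "W = V - {v}"
    have V: "V = insert v W" "v \<notin> W" "finite W" using v less.prems(1) by (auto simp: W_def)
    have cV: "card V = Suc (card W)" using V by simp
    have IH: "real (card (G \<inter> all_edges W))
        \<le> c * real ((card W choose 2) + card W) + real (n0 choose 2)"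
    proof (rule less.hyps)
      show "card W < card V" "finite W" using V cV by auto
      show "\<exists>v\<in>U. real (card {w \<in> U. {v, w} \<in> G}) \<le> c * real (card U)"
        if "U \<subseteq> W" "U \<noteq> {}" "n0 \<le> card U" for U
        using that less.prems(2)[of U] by (auto simp: W_def)
    qed
    have "card {w \<in> W. {v, w} \<in> G} \<le> card {w \<in> V. {v, w} \<in> G}"
      using less.prems(1) by (intro card_mono) (auto simp: W_def)
    then have "real (card {w \<in> W. {v, w} \<in> G}) \<le> c * real (card V)"
      using dv by linarith
    moreover have "card (G \<inter> all_edges V) = card (G \<inter> all_edges W) + card {w \<in> W. {v, w} \<in> G}"
      unfolding V(1) using V by (intro card_edges_insert) auto
    moreover have "(card V choose 2) + card V = (card W choose 2) + card W + card V"
      unfolding cV by (simp add: numeral_2_eq_2)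
    ultimately show ?thesis using IH by (simp only: of_nat_add distrib_left)
  qed
qed

section \<open>Complete multipartite subgraphs of dense graphs\<close>

text \<open>Disjointness of the parts is omitted: a common vertex would be a loop, which the graphs below lack.\<close>

definition contains_multipartite :: "'a set set \<Rightarrow> 'a set \<Rightarrow> nat \<Rightarrow> nat \<Rightarrow> bool" where
  "contains_multipartite G V s t \<longleftrightarrow>
     (\<exists>A. (\<forall>i<s. A i \<subseteq> V \<and> card (A i) = t) \<and>
          (\<forall>i<s. \<forall>j<s. i \<noteq> j \<longrightarrow> (\<forall>x\<in>A i. \<forall>y\<in>A j. {x, y} \<in> G)))"

lemma contains_multipartite_mono:
  assumes "contains_multipartite G W s t" and "W \<subseteq> V"
  shows "contains_multipartite G V s t"
proof -
  obtain A where "\<forall>i<s. A i \<subseteq> W \<and> card (A i) = t"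
    and "\<forall>i<s. \<forall>j<s. i \<noteq> j \<longrightarrow> (\<forall>x\<in>A i. \<forall>y\<in>A j. {x, y} \<in> G)"
    using assms(1) unfolding contains_multipartite_def by blast
  then show ?thesis
    using assms(2) unfolding contains_multipartite_def
    by (intro exI[of _ A] conjI allI impI) blast+
qed

text \<open>Trades \<open>s\<close> parts of large size \<open>T\<close> for \<open>s + 1\<close>
  parts of size \<open>t\<close>. Many vertices have \<open>t\<close> neighbours in each old part;
  by pigeonhole, \<open>t\<close> of them share the same \<open>t\<close>-subsets, and these
  vertices form the new part. The bound on \<open>T\<close> makes the loss \<open>t\<close> at most
  half of the gain \<open>\<epsilon> * T\<close>; the bound on \<open>card V\<close> pays for the
  \<open>2 ^ (T * s)\<close> pigeonholes.\<close>

lemma contains_multipartite_Suc: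
  fixes \<epsilon> :: real
  assumes fin: "finite V" and "0 < \<epsilon>" and "1 \<le> s" "s \<le> r" and "0 < t"
    and deg: "\<And>v. v \<in> V \<Longrightarrow>
      (1 - 1 / real r + \<epsilon>) * real (card V) \<le> real (card {w \<in> V. {v, w} \<in> G})"
    and T: "2 * real t \<le> \<epsilon> * real T"
    and n: "2 * real s * real t * 2 ^ (T * s) \<le> \<epsilon> * real (card V)"
    and K: "contains_multipartite G V s T"
  shows "contains_multipartite G V (Suc s) t"
proof -
  obtain A where A: "\<And>i. i < s \<Longrightarrow> A i \<subseteq> V" "\<And>i. i < s \<Longrightarrow> card (A i) = T"
    and AG: "\<And>i j x y. i < s \<Longrightarrow> j < s \<Longrightarrow> i \<noteq> j \<Longrightarrow> x \<in> A i \<Longrightarrow> y \<in> A j \<Longrightarrow> {x, y} \<in> G"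
    using K unfolding contains_multipartite_def by metis
  have finA: "finite (A i)" if "i < s" for i using A(1)[OF that] fin finite_subset by blast
  define n where "n = real (card V)"
  define N where "N i w = {x \<in> A i. {x, w} \<in> G}" for i w
  define W where "W = {w \<in> V. \<forall>i<s. t \<le> card (N i w)}"
  have finW: "finite W" using fin by (simp add: W_def)
  have Tpos: "0 < real T" using T \<open>0 < t\<close> \<open>0 < \<epsilon>\<close> by (cases "T = 0") auto
  have NT: "card (N i w) \<le> T" if "i < s" for i w
    using card_mono[OF finA[OF that], of "N i w"] A(2)[OF that] by (auto simp: N_def)
  \<comment> \<open>A vertex outside \<open>W\<close> has fewer than \<open>t\<close> neighbours in
    some part and at most \<open>T\<close> in each other part. A vertex of \<open>W\<close> is
    allowed an extra \<open>s * T\<close>, which is generous but costs only a constant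
    factor.\<close>
  have nb: "real (\<Sum>i<s. card (N i w)) \<le> (real s - 1) * T + t + (if w \<in> W then real s * T else 0)"
    if w: "w \<in> V" for w
  proof (cases "w \<in> W")
    case True
    have "(\<Sum>i<s. card (N i w)) \<le> s * T"
      using sum_bounded_above[of "{..<s}" "\<lambda>i. card (N i w)" T] NT by simp
    then have "real (\<Sum>i<s. card (N i w)) \<le> real s * T"
      by (metis of_nat_mono of_nat_mult)
    moreover have "0 \<le> (real s - 1) * T" using \<open>1 \<le> s\<close> by simp
    ultimately show ?thesis using True by simp
  next
    case False
    then obtain k where k: "k < s" "card (N k w) < t" using w False by (auto simp: W_def not_le)
    have "(\<Sum>i<s. card (N i w)) = card (N k w) + (\<Sum>i\<in>{..<s}-{k}. card (N i w))"
      using k by (simp add: sum.remove)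
    moreover have "(\<Sum>i\<in>{..<s}-{k}. card (N i w)) \<le> (s - 1) * T"
      using sum_bounded_above[of "{..<s}-{k}" "\<lambda>i. card (N i w)" T] NT k by simp
    ultimately have "(\<Sum>i<s. card (N i w)) \<le> (s - 1) * T + t" using k by linarith
    then have "real (\<Sum>i<s. card (N i w)) \<le> real ((s - 1) * T + t)" by (rule of_nat_mono)
    then show ?thesis using False \<open>1 \<le> s\<close> by (simp add: of_nat_diff)
  qed
  \<comment> \<open>Double count the pairs of a vertex in a part and a neighbour of it: linearly many vertices
    have at least \<open>t\<close> neighbours in every part.\<close>
  have "real s * T * ((1 - 1 / real r + \<epsilon>) * n)
          = (\<Sum>i<s. \<Sum>x\<in>A i. (1 - 1 / real r + \<epsilon>) * n)"
    using A(2) by simp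
  also have "\<dots> \<le> (\<Sum>i<s. \<Sum>x\<in>A i. real (card {w \<in> V. {x, w} \<in> G}))"
    unfolding n_def using A(1) by (intro sum_mono deg) auto
  also have "\<dots> = (\<Sum>i<s. \<Sum>x\<in>A i. \<Sum>w\<in>V. if {x, w} \<in> G then 1 else 0)"
    by (simp add: fin flip: sum.inter_filter)
  also have "\<dots> = (\<Sum>i<s. \<Sum>w\<in>V. \<Sum>x\<in>A i. if {x, w} \<in> G then 1 else 0)"
    by (intro sum.cong refl sum.swap)
  also have "\<dots> = (\<Sum>i<s. \<Sum>w\<in>V. real (card (N i w)))"
    using finA by (intro sum.cong refl) (simp add: N_def flip: sum.inter_filter)
  also have "\<dots> = (\<Sum>w\<in>V. real (\<Sum>i<s. card (N i w)))"
    by (subst sum.swap) simp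
  also have "\<dots> \<le> (\<Sum>w\<in>V. (real s - 1) * T + t + (if w \<in> W then real s * T else 0))"
    by (intro sum_mono nb)
  also have "\<dots> = n * ((real s - 1) * T + t) + real (card W) * (real s * T)"
  proof -
    have "V \<inter> W = W" by (auto simp: W_def)
    then have "(\<Sum>w\<in>V. if w \<in> W then real s * T else 0) = real (card W) * (real s * T)"
      using fin by (simp flip: sum.inter_restrict)
    then show ?thesis by (simp add: sum.distrib n_def)
  qed
  finally have count: "real s * T * ((1 - 1 / real r + \<epsilon>) * n)
      \<le> n * ((real s - 1) * T + t) + real (card W) * (real s * T)" .
  \<comment> \<open>Here \<open>s \<le> r\<close> enters: \<open>s / r \<le> 1\<close>, so the
    average degree into the parts exceeds what vertices outside \<open>W\<close> can account
    for.\<close>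
  have "\<epsilon> \<le> real s * (1 - 1 / real r + \<epsilon>) - (real s - 1)"
  proof -
    have "real s / real r \<le> 1" using \<open>s \<le> r\<close> \<open>1 \<le> s\<close> by (simp add: field_simps)
    moreover have "\<epsilon> \<le> real s * \<epsilon>" using \<open>1 \<le> s\<close> \<open>0 < \<epsilon>\<close> by simp
    ultimately show ?thesis by (simp add: algebra_simps)
  qed
  then have "n * T * \<epsilon> \<le> n * T * (real s * (1 - 1 / real r + \<epsilon>) - (real s - 1))"
    by (intro mult_left_mono) (auto simp: n_def)
  moreover have "n * (2 * real t) \<le> n * (\<epsilon> * real T)"
    using T by (intro mult_left_mono) (auto simp: n_def)
  ultimately have "n * T * \<epsilon> \<le> 2 * (real (card W) * (real s * T))"
    using count by (simp add: algebra_simps)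
  then have "T * (n * \<epsilon>) \<le> T * (2 * (real (card W) * real s))" by (simp add: algebra_simps)
  then have "n * \<epsilon> \<le> 2 * (real (card W) * real s)" using Tpos by (subst (asm) mult_le_cancel_left_pos)
  then have "(2 * real s) * (real t * 2 ^ (T * s)) \<le> (2 * real s) * real (card W)"
    using assms(8) by (simp add: n_def algebra_simps)
  then have "real t * 2 ^ (T * s) \<le> real (card W)"
    using \<open>1 \<le> s\<close> by (subst (asm) mult_le_cancel_left_pos) auto
  then have "real (t * 2 ^ (T * s)) \<le> real (card W)" by simp
  then have cW: "t * 2 ^ (T * s) \<le> card W" by (simp only: of_nat_le_iff)
  have "\<exists>B. \<forall>i<s. B i \<subseteq> N i w \<and> card (B i) = t" if "w \<in> W" for w
  proof -
    have "\<forall>i\<in>{..<s}. \<exists>B. B \<subseteq> N i w \<and> card B = t"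
    proof
      fix i assume "i \<in> {..<s}"
      then have "t \<le> card (N i w)" using that by (auto simp: W_def)
      then show "\<exists>B. B \<subseteq> N i w \<and> card B = t" by (meson obtain_subset_with_card_n)
    qed
    from bchoice[OF this] show ?thesis by auto
  qed
  then have "\<forall>w\<in>W. \<exists>B. \<forall>i<s. B i \<subseteq> N i w \<and> card (B i) = t" by blast
  from bchoice[OF this] obtain B
    where B: "\<And>w i. w \<in> W \<Longrightarrow> i < s \<Longrightarrow> B w i \<subseteq> N i w \<and> card (B w i) = t" by auto
  \<comment> \<open>Restricting to the indices below \<open>s\<close> makes the choices elements of
    the finite product \<open>?Q\<close>, whose size is \<open>2 ^ (T * s)\<close>.\<close>
  define h where "h w = restrict (B w) {..<s}" for w
  let ?Q = "PiE {..<s} (\<lambda>i. Pow (A i))"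
  have "h \<in> W \<rightarrow> ?Q"
  proof
    fix w assume "w \<in> W"
    then have "B w i \<subseteq> A i" if "i < s" for i using B[OF _ that, of w] by (auto simp: N_def)
    then show "h w \<in> ?Q" by (simp add: h_def)
  qed
  moreover have finQ: "finite ?Q" using finA by (intro finite_PiE) auto
  moreover have cQ: "card ?Q = 2 ^ (T * s)"
    using A(2) finA by (simp add: card_PiE card_Pow power_mult)
  moreover have "?Q \<noteq> {}" using cQ by (metis card.empty power_not_zero zero_neq_numeral)
  ultimately obtain q where q: "q \<in> ?Q" "card W \<le> card (h -` {q} \<inter> W) * card ?Q"
    using pigeonhole_card[of h W ?Q] finW by auto
  then have "t * 2 ^ (T * s) \<le> card (h -` {q} \<inter> W) * 2 ^ (T * s)"
    using cW unfolding cQ by (meson order_trans)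
  then have "t \<le> card (h -` {q} \<inter> W)" by simp
  then obtain Y where Y: "Y \<subseteq> h -` {q} \<inter> W" "card Y = t"
    by (meson obtain_subset_with_card_n)
  \<comment> \<open>Any one vertex of \<open>Y\<close> shows that the common sets \<open>q i\<close>
    have \<open>t\<close> elements.\<close>
  have "Y \<noteq> {}" using Y \<open>0 < t\<close> by auto
  have qB: "q i = B y i" if "y \<in> Y" "i < s" for y i
    using that Y by (auto simp: h_def)
  have q1: "q i \<subseteq> A i" "card (q i) = t" if "i < s" for i
  proof -
    obtain y where y: "y \<in> Y" using \<open>Y \<noteq> {}\<close> by blast
    then have "y \<in> W" using Y(1) by auto
    then show "q i \<subseteq> A i" "card (q i) = t"
      using B[of y i] qB[OF y that] that by (auto simp: N_def)
  qed
  have q2: "{x, y} \<in> G" if "i < s" "x \<in> q i" "y \<in> Y" for x y i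
    using B[of y i] qB[of y i] that Y(1) by (auto simp: N_def)
  have YV: "Y \<subseteq> V" using Y(1) by (auto simp: W_def)
  let ?A = "\<lambda>i. if i < s then q i else Y"
  show ?thesis unfolding contains_multipartite_def
  proof (intro exI[of _ ?A] conjI allI impI ballI)
    fix i assume "i < Suc s"
    show "?A i \<subseteq> V" using q1(1)[of i] A(1)[of i] YV by auto
    show "card (?A i) = t" using q1 Y by auto
  next
    fix i j x y assume "i < Suc s" "j < Suc s" "i \<noteq> j" "x \<in> ?A i" "y \<in> ?A j"
    then consider "i < s" "j < s" | "i < s" "j = s" | "i = s" "j < s" by linarith
    then show "{x, y} \<in> G"
    proof cases
      case 1
      then show ?thesis using \<open>i \<noteq> j\<close> \<open>x \<in> ?A i\<close> \<open>y \<in> ?A j\<close> q1 by (intro AG[of i j]) auto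
    next
      case 2
      then show ?thesis using \<open>x \<in> ?A i\<close> \<open>y \<in> ?A j\<close> q2[of i x y] by auto
    next
      case 3
      then show ?thesis using \<open>x \<in> ?A i\<close> \<open>y \<in> ?A j\<close> q2[of j y x] by (auto simp: insert_commute)
    qed
  qed
qed

text \<open>Induction on the number of parts, with \<open>t\<close> arbitrary because
  \<open>s + 1\<close> parts of size \<open>t\<close> are built from \<open>s\<close> parts of a
  larger size \<open>T\<close>. A single part is just any set of \<open>t\<close> vertices. The
  threshold is uniform over all \<open>V\<close> and \<open>G\<close>.\<close>

lemma Erdos_Stone_min_degree:
  fixes \<epsilon> :: real
  assumes "0 < \<epsilon>" and "1 \<le> s" "s \<le> Suc r" and "0 < t"
  shows "\<exists>n0. \<forall>(V :: 'a set) G. finite V \<longrightarrow> n0 \<le> card V \<longrightarrow>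
    (\<forall>v\<in>V. (1 - 1 / real r + \<epsilon>) * real (card V) \<le> real (card {w \<in> V. {v, w} \<in> G})) \<longrightarrow>
    contains_multipartite G V s t"
  using assms(2-4)
proof (induction s arbitrary: t rule: dec_induct)
  case base
  show ?case
  proof (intro exI[of _ t] allI impI)
    fix V :: "'a set" and G assume "t \<le> card V"
    then obtain B where "B \<subseteq> V" "card B = t" by (meson obtain_subset_with_card_n)
    then show "contains_multipartite G V 1 t"
      unfolding contains_multipartite_def by (intro exI[of _ "\<lambda>_. B"]) auto
  qed
next
  case (step s)
  obtain T where T: "2 * real t / \<epsilon> \<le> real T" using real_arch_simple by blast
  then have T': "2 * real t \<le> \<epsilon> * real T" using \<open>0 < \<epsilon>\<close> by (simp add: field_simps)
  with \<open>0 < t\<close> \<open>0 < \<epsilon>\<close> have "0 < T" by (cases "T = 0") auto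
  have "\<exists>n0. \<forall>(V :: 'a set) G. finite V \<longrightarrow> n0 \<le> card V \<longrightarrow>
    (\<forall>v\<in>V. (1 - 1 / real r + \<epsilon>) * real (card V) \<le> real (card {w \<in> V. {v, w} \<in> G})) \<longrightarrow>
    contains_multipartite G V s T"
    using step.IH[of T] step.prems \<open>0 < T\<close> by simp
  then obtain n1 where n1: "\<And>(V :: 'a set) G. finite V \<Longrightarrow> n1 \<le> card V \<Longrightarrow>
    (\<forall>v\<in>V. (1 - 1 / real r + \<epsilon>) * real (card V) \<le> real (card {w \<in> V. {v, w} \<in> G})) \<Longrightarrow>
    contains_multipartite G V s T"
    by blast
  obtain n2 where n2: "2 * real s * real t * 2 ^ (T * s) / \<epsilon> \<le> real n2"
    using real_arch_simple by blast
  show ?case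
  proof (intro exI[of _ "max n1 n2"] allI impI)
    fix V :: "'a set" and G
    assume V: "finite V" "max n1 n2 \<le> card V"
      and deg: "\<forall>v\<in>V. (1 - 1 / real r + \<epsilon>) * real (card V) \<le> real (card {w \<in> V. {v, w} \<in> G})"
    have "2 * real s * real t * 2 ^ (T * s) / \<epsilon> \<le> real (card V)" using n2 V by linarith
    then have "2 * real s * real t * 2 ^ (T * s) \<le> \<epsilon> * real (card V)"
      using \<open>0 < \<epsilon>\<close> by (simp add: field_simps)
    then show "contains_multipartite G V (Suc s) t"
      using V deg T' step \<open>0 < \<epsilon>\<close> n1[of V G]
      by (intro contains_multipartite_Suc[where r = r and T = T and \<epsilon> = \<epsilon>]) auto
  qed
qed

text \<open>Half of \<open>\<epsilon>\<close> goes into the minimum degree version: every large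
  vertex subset then has a vertex of degree below \<open>d\<close> times its order, so the
  degenerate bound applies. The other half absorbs the lower order terms
  \<open>d * n + k\<close>.\<close>

theorem Erdos_Stone:
  fixes \<epsilon> :: real
  assumes "0 < \<epsilon>" and "1 \<le> r" and "0 < t"
  shows "\<exists>N. \<forall>(V :: 'a set) G. finite V \<longrightarrow> N \<le> card V \<longrightarrow>
    \<not> contains_multipartite G V (Suc r) t \<longrightarrow>
    real (card (G \<inter> all_edges V)) \<le> (1 - 1 / real r + \<epsilon>) * real (card V choose 2)"
proof -
  define d where "d = 1 - 1 / real r + \<epsilon> / 2"
  have "1 / real r \<le> 1" using assms by simp
  then have d0: "0 \<le> d" using assms by (simp add: d_def)
  obtain n0 where n0: "\<And>(V :: 'a set) G. finite V \<Longrightarrow> n0 \<le> card V \<Longrightarrow>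
    (\<forall>v\<in>V. d * real (card V) \<le> real (card {w \<in> V. {v, w} \<in> G})) \<Longrightarrow>
    contains_multipartite G V (Suc r) t"
    using Erdos_Stone_min_degree[of "\<epsilon> / 2" "Suc r" r t] assms unfolding d_def by auto
  define k where "k = real (n0 choose 2)"
  have "0 \<le> k" by (simp add: k_def)
  \<comment> \<open>Chosen so that \<open>n - 1 \<ge> N\<close> yields
    \<open>4 * (d + k) \<le> \<epsilon> * (n - 1)\<close>; multiplying by \<open>n / 4\<close> turns
    this into half of \<open>\<epsilon>\<close> times the number of pairs. Asking for
    \<open>Suc N\<close> vertices gives both \<open>n \<ge> 1\<close> and
    \<open>n - 1 \<ge> N\<close>.\<close>
  obtain N where N: "4 * (d + k) / \<epsilon> \<le> real N" using real_arch_simple by blast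
  show ?thesis
  proof (intro exI[of _ "Suc N"] allI impI)
    fix V :: "'a set" and G
    assume V: "finite V" "Suc N \<le> card V" and free: "\<not> contains_multipartite G V (Suc r) t"
    define n where "n = real (card V)"
    have ch: "real (card V choose 2) = n * (n - 1) / 2"
      using V unfolding n_def by (simp add: real_choose_two)
    have "real (card (G \<inter> all_edges V)) \<le> d * real ((card V choose 2) + card V) + k"
      unfolding k_def
    proof (rule degenerate_edge_bound[OF V(1) d0])
      fix W assume W: "W \<subseteq> V" "W \<noteq> {}" "n0 \<le> card W"
      have "\<not> contains_multipartite G W (Suc r) t"
        using free W contains_multipartite_mono by blast
      then show "\<exists>v\<in>W. real (card {w \<in> W. {v, w} \<in> G}) \<le> d * real (card W)"
        using n0[of W G] W finite_subset[OF W(1) V(1)] by force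
    qed
    moreover have "d * n + k \<le> \<epsilon> / 2 * (n * (n - 1) / 2)"
    proof -
      have n1: "1 \<le> n" "real N \<le> n - 1" using V by (auto simp: n_def)
      have "d * n + k \<le> n * (d + k)" using n1 mult_left_mono[of 1 n k] \<open>0 \<le> k\<close>
        by (simp add: algebra_simps)
      also have "4 * (d + k) \<le> \<epsilon> * (n - 1)"
      proof -
        have "4 * (d + k) / \<epsilon> \<le> n - 1" using N n1 by linarith
        then show ?thesis using assms(1) by (simp add: field_simps)
      qed
      then have "n * (d + k) \<le> n * (\<epsilon> * (n - 1) / 4)" using n1 by (intro mult_left_mono) auto
      finally show ?thesis by (simp add: algebra_simps)
    qed
    ultimately have "real (card (G \<inter> all_edges V)) \<le> d * (n * (n - 1) / 2) + \<epsilon> / 2 * (n * (n - 1) / 2)"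
      unfolding of_nat_add ch n_def[symmetric] by (simp only: distrib_left)
    moreover have "1 - 1 / real r + \<epsilon> = d + \<epsilon> / 2" by (simp add: d_def)
    ultimately show "real (card (G \<inter> all_edges V)) \<le> (1 - 1 / real r + \<epsilon>) * real (card V choose 2)"
      unfolding ch by (simp only: distrib_right)
  qed
qed

section \<open>Representatives and colourings\<close>

text \<open>Greedy choice with \<open>X\<close> as the set of forbidden colours. Each chosen colour
  moves into \<open>X\<close> while its index leaves \<open>I\<close>, so
  \<open>card I + card X\<close> stays constant and the size hypothesis survives.\<close>

lemma has_sdr_avoiding:
  assumes "finite I" and "finite X" and "\<And>i. i \<in> I \<Longrightarrow> card I + card X \<le> card (A i)"
  shows "\<exists>a. (\<forall>i\<in>I. a i \<in> A i - X) \<and> inj_on a I"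
  using assms
proof (induction I arbitrary: X rule: finite_induct)
  case empty
  then show ?case by simp
next
  case (insert k I)
  have "card X < card (A k)" using insert.prems(2)[of k] insert.hyps by simp
  then obtain c where c: "c \<in> A k" "c \<notin> X"
    using insert.prems(1) by (meson card_mono linorder_not_less subsetI)
  obtain a where a: "\<forall>i\<in>I. a i \<in> A i - insert c X" "inj_on a I"
    using insert.IH[of "insert c X"] insert.prems insert.hyps c by fastforce
  have "inj_on (a(k := c)) (insert k I)"
    using a insert.hyps by (auto simp: inj_on_def)
  moreover have "\<forall>i\<in>insert k I. (a(k := c)) i \<in> A i - X"
    using a c by auto
  ultimately show ?case by blast
qed

text \<open>The exceptional set chooses first. The remaining \<open>card I - 1\<close> sets then
  have one forbidden colour, which is exactly what \<open>card I\<close> elements can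
  accommodate.\<close>

lemma has_sdr_one_small:
  assumes "finite I" and "k \<in> I" and "A k \<noteq> {}"
    and "\<And>i. i \<in> I \<Longrightarrow> i \<noteq> k \<Longrightarrow> card I \<le> card (A i)"
  shows "has_sdr I A"
proof -
  obtain c where c: "c \<in> A k" using assms(3) by blast
  have "card (I - {k}) + card {c} = card I" using card_Suc_Diff1[OF assms(1,2)] by simp
  then obtain a where a: "\<forall>i\<in>I - {k}. a i \<in> A i - {c}" "inj_on a (I - {k})"
    using has_sdr_avoiding[of "I - {k}" "{c}" A] assms by auto
  have "inj_on (a(k := c)) I" using a by (auto simp: inj_on_def)
  moreover have "\<forall>i\<in>I. (a(k := c)) i \<in> A i" using a c by auto
  ultimately show ?thesis unfolding has_sdr_def by blast
qed

section \<open>Chromatic numbers after deleting edges\<close>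

lemma edgeE:
  assumes "e \<in> all_edges V"
  obtains u v where "e = {u, v}" "u \<in> V" "v \<in> V" "u \<noteq> v"
  using assms by (auto simp: all_edges_def card_2_iff)

lemma simple_graph_del_edges: "simple_graph H \<Longrightarrow> simple_graph (del_edges H S)"
  by (auto simp: simple_graph_def del_edges_def)

lemma finite_edges: "simple_graph H \<Longrightarrow> finite (edges H)"
  unfolding simple_graph_def using finite_all_edges finite_subset by blast

text \<open>The least number of colours is attained because numbering the vertices is a proper
  colouring of a loopless finite graph; additional colours do no harm.\<close>

lemma chromatic_number_le_iff:
  assumes "simple_graph G"
  shows "chromatic_number G \<le> k \<longleftrightarrow> (\<exists>c. proper_colouring G k c)"
proof
  assume "\<exists>c. proper_colouring G k c"
  then show "chromatic_number G \<le> k" unfolding chromatic_number_def by (rule Least_le)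
next
  assume le: "chromatic_number G \<le> k"
  have fin: "finite (verts G)" and E: "edges G \<subseteq> all_edges (verts G)"
    using assms by (auto simp: simple_graph_def)
  obtain g where g: "bij_betw g (verts G) {0..<card (verts G)}"
    using ex_bij_betw_finite_nat[OF fin] by blast
  have "proper_colouring G (card (verts G)) g"
    unfolding proper_colouring_def
  proof (intro conjI ballI impI)
    show "g \<in> verts G \<rightarrow> {..<card (verts G)}" using g by (auto simp: bij_betw_def)
    fix u v assume "u \<in> verts G" "v \<in> verts G" "{u, v} \<in> edges G"
    moreover from this have "u \<noteq> v" using E by (auto simp: all_edges_def)
    ultimately show "g u \<noteq> g v" using g by (auto simp: bij_betw_def inj_on_def)
  qed
  then have "\<exists>c. proper_colouring G (chromatic_number G) c"
    unfolding chromatic_number_def by (rule LeastI[where P = "\<lambda>k. \<exists>c. proper_colouring G k c", OF exI])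
  then obtain c where "proper_colouring G (chromatic_number G) c" ..
  then have "proper_colouring G k c" 
    using le Pi_mono[of "verts G" "\<lambda>_. {..<chromatic_number G}" "\<lambda>_. {..<k}"]
    by (auto simp: proper_colouring_def)
  then show "\<exists>c. proper_colouring G k c" by blast
qed

lemma bipartite_iff_chromatic_number:
  assumes "simple_graph G"
  shows "bipartite G \<longleftrightarrow> chromatic_number G \<le> 2"
  unfolding chromatic_number_le_iff[OF assms]
proof
  assume "bipartite G"
  then obtain A B where AB: "A \<union> B = verts G" "A \<inter> B = {}"
    "\<forall>e\<in>edges G. \<exists>a\<in>A. \<exists>b\<in>B. e = {a, b}"
    unfolding bipartite_def by blast
  have "proper_colouring G 2 (\<lambda>v. if v \<in> A then 0 else 1)"
    unfolding proper_colouring_def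
  proof (intro conjI ballI impI)
    fix u v assume "{u, v} \<in> edges G"
    then obtain a b where "a \<in> A" "b \<in> B" "{u, v} = {a, b}" using AB(3) by blast
    then show "(if u \<in> A then 0 else 1) \<noteq> (if v \<in> A then 0 else (1::nat))"
      using AB(2) by (auto simp: doubleton_eq_iff)
  qed auto
  then show "\<exists>c. proper_colouring G 2 c" by blast
next
  assume "\<exists>c. proper_colouring G 2 c"
  then obtain c where c: "proper_colouring G 2 c" ..
  let ?A = "{v \<in> verts G. c v = 0}" and ?B = "{v \<in> verts G. c v = 1}"
  have c2: "c v = 0 \<or> c v = 1" if "v \<in> verts G" for v
    using c that by (auto simp: proper_colouring_def less_2_cases_iff)
  show "bipartite G" unfolding bipartite_def
  proof (rule exI[of _ ?A], rule exI[of _ ?B], intro conjI ballI)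
    fix e assume e: "e \<in> edges G"
    then have "e \<in> all_edges (verts G)" using assms by (auto simp: simple_graph_def)
    then obtain u v where uv: "e = {u, v}" "u \<in> verts G" "v \<in> verts G" by (elim edgeE)
    then have ne: "c u \<noteq> c v" using c e by (auto simp: proper_colouring_def)
    show "\<exists>a\<in>?A. \<exists>b\<in>?B. e = {a, b}"
    proof (cases "c u = 0")
      case True
      then show ?thesis using uv ne c2[of v] by auto
    next
      case False
      then show ?thesis using uv ne c2[of u] c2[of v]
        by (intro bexI[of _ v] bexI[of _ u]) (auto simp: insert_commute)
    qed
  qed (use c2 in auto)
qed

text \<open>The bound on \<open>j\<close> makes the set of chromatic numbers under
  \<open>Min\<close> nonempty, and there are finitely many edge sets to delete.\<close>

lemma
  assumes "simple_graph H" and "j \<le> card (edges H)"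
  shows chi_del_attained: "\<exists>S\<subseteq>edges H. card S = j \<and> chi_del H j = chromatic_number (del_edges H S)"
    and chi_del_le: "S \<subseteq> edges H \<Longrightarrow> card S = j \<Longrightarrow> chi_del H j \<le> chromatic_number (del_edges H S)"
proof -
  let ?X = "{chromatic_number (del_edges H S) | S. S \<subseteq> edges H \<and> card S = j}"
  have "?X = (\<lambda>S. chromatic_number (del_edges H S)) ` {S. S \<subseteq> edges H \<and> card S = j}" by auto
  then have fin: "finite ?X" using finite_edges[OF assms(1)] by simp
  obtain S0 where "S0 \<subseteq> edges H" "card S0 = j" using assms(2) by (meson obtain_subset_with_card_n)
  then have "?X \<noteq> {}" by auto
  from Min_in[OF fin this] show "\<exists>S\<subseteq>edges H. card S = j \<and> chi_del H j = chromatic_number (del_edges H S)"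
    unfolding chi_del_def by auto
  show "chi_del H j \<le> chromatic_number (del_edges H S)" if "S \<subseteq> edges H" "card S = j"
    unfolding chi_del_def using fin that by (intro Min_le) auto
qed

text \<open>Both cases of the definition become the density \<open>1 - 1 / r\<close> of a balanced
  complete \<open>r\<close>-partite graph, where \<open>r = 1\<close> stands for the degenerate
  value 0.\<close>

lemma pi_del_eq: "pi_del H j = 1 - 1 / real (max (chi_del H j) 2 - 1)"
  by (auto simp: pi_del_def of_nat_diff max_def)

lemma pi_del_nonneg: "0 \<le> pi_del H j"
  by (auto simp: pi_del_def field_simps)

text \<open>Colour the vertices in turn, giving each new vertex a least used colour. It then creates
  at most \<open>n / r\<close> monochromatic pairs, and these sum to a \<open>1 / r\<close> fraction
  of all pairs. The bound is exact for every \<open>n\<close>, so it can be passed to an infimum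
  without an error term.\<close>

lemma colouring_few_monochromatic_edges:
  assumes "1 \<le> r"
  shows "\<exists>c. (\<forall>i. c i < r) \<and>
    r * card ({e. is_singleton (c ` e)} \<inter> all_edges {1..n}) \<le> n choose 2"
proof (induction n)
  case 0
  have "all_edges {1..0::nat} = {}" by (auto simp: all_edges_def)
  then show ?case using assms by (intro exI[of _ "\<lambda>_. 0"]) auto
next
  case (Suc n)
  then obtain c where c: "\<And>i. c i < r"
    "r * card ({e. is_singleton (c ` e)} \<inter> all_edges {1..n}) \<le> n choose 2" by blast
  have "\<exists>k<r. r * card {i \<in> {1..n}. c i = k} \<le> n"
  proof (rule ccontr)
    assume "\<not> ?thesis"
    then have "(\<Sum>k<r. n) < (\<Sum>k<r. r * card {i \<in> {1..n}. c i = k})"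
      using assms by (intro sum_strict_mono) (auto simp: not_le lessThan_empty_iff)
    also have "\<dots> = r * (\<Sum>k<r. card {i \<in> {1..n}. c i = k})" by (simp add: sum_distrib_left)
    also have "(\<Sum>k<r. card {i \<in> {1..n}. c i = k}) = card (\<Union>k<r. {i \<in> {1..n}. c i = k})"
      by (subst card_UN_disjoint) auto
    also have "(\<Union>k<r. {i \<in> {1..n}. c i = k}) = {1..n}" using c(1) by auto
    finally show False by simp
  qed
  then obtain k where k: "k < r" "r * card {i \<in> {1..n}. c i = k} \<le> n" by blast
  define c' where "c' = c(Suc n := k)"
  let ?M = "\<lambda>c::nat \<Rightarrow> nat. {e. is_singleton (c ` e)}"
  have "?M c' \<inter> all_edges {1..n} = ?M c \<inter> all_edges {1..n}"
  proof -
    have "c' ` e = c ` e" if "e \<in> all_edges {1..n}" for e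
      using that by (intro image_cong) (auto simp: c'_def all_edges_def)
    then show ?thesis by auto
  qed
  moreover have "{w \<in> {1..n}. {Suc n, w} \<in> ?M c'} = {i \<in> {1..n}. c i = k}"
    by (auto simp: c'_def is_singleton_def)
  moreover have "{1..Suc n} = insert (Suc n) {1..n}" by auto
  ultimately have "card (?M c' \<inter> all_edges {1..Suc n})
      = card (?M c \<inter> all_edges {1..n}) + card {i \<in> {1..n}. c i = k}"
    using card_edges_insert[of "{1..n}" "Suc n" "?M c'"] by simp
  then have "r * card (?M c' \<inter> all_edges {1..Suc n}) \<le> Suc n choose 2"
    using c(2) k(2) by (simp add: distrib_left numeral_2_eq_2)
  moreover have "\<forall>i. c' i < r" using c(1) k(1) by (simp add: c'_def)
  ultimately show ?case by blast
qed

text \<open>Each colour class goes injectively into its own part, and a part of size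
  \<open>card (verts H)\<close> has room for any class. Two vertices of different colours cannot
  meet in one image, since that image would carry a loop.\<close>

lemma embed_in_multipartite:
  assumes H: "simple_graph H" and c: "proper_colouring H k c"
    and G: "contains_multipartite G V k (card (verts H))" and loopless: "\<And>x. {x} \<notin> G"
  shows "\<exists>f. inj_on f (verts H) \<and> f ` verts H \<subseteq> V \<and> (\<forall>e\<in>edges H. f ` e \<in> G)"
proof -
  obtain A where A: "\<And>i. i < k \<Longrightarrow> A i \<subseteq> V" "\<And>i. i < k \<Longrightarrow> card (A i) = card (verts H)"
    and AG: "\<And>i j x y. i < k \<Longrightarrow> j < k \<Longrightarrow> i \<noteq> j \<Longrightarrow> x \<in> A i \<Longrightarrow> y \<in> A j \<Longrightarrow> {x, y} \<in> G"
    using G unfolding contains_multipartite_def by metis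
  have finH: "finite (verts H)" and E: "edges H \<subseteq> all_edges (verts H)"
    using H by (auto simp: simple_graph_def)
  have ck: "c v < k" if "v \<in> verts H" for v using c that by (auto simp: proper_colouring_def)
  show ?thesis
  proof (cases "verts H = {}")
    \<comment> \<open>Separated because a part with \<open>card\<close> 0 could be infinite;
      otherwise the positive cardinality makes the parts finite.\<close>
    case True
    then have "edges H = {}" using E by (auto simp: all_edges_def)
    then show ?thesis using True by simp
  next
    case False
    have "\<exists>g. g ` verts H \<subseteq> A i \<and> inj_on g (verts H)" if "i < k" for i
    proof -
      have "finite (A i)"
        using A(2)[OF that] False finH by (metis card_0_eq card.infinite)
      then show ?thesis using card_le_inj[OF finH, of "A i"] A(2)[OF that] by auto
    qed
    then have "\<forall>i\<in>{..<k}. \<exists>g. g ` verts H \<subseteq> A i \<and> inj_on g (verts H)" by blast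
    from bchoice[OF this] obtain g
      where g: "\<And>i. i < k \<Longrightarrow> g i ` verts H \<subseteq> A i" "\<And>i. i < k \<Longrightarrow> inj_on (g i) (verts H)" by auto
    define f where "f v = g (c v) v" for v
    have fA: "f v \<in> A (c v)" if "v \<in> verts H" for v using g(1)[OF ck[OF that]] that by (auto simp: f_def)
    show ?thesis
    proof (intro exI[of _ f] conjI ballI)
      show "inj_on f (verts H)"
      proof (rule inj_onI)
        fix u v assume uv: "u \<in> verts H" "v \<in> verts H" "f u = f v"
        show "u = v"
        proof (cases "c u = c v")
          case True
          then show ?thesis using uv g(2)[OF ck[OF uv(1)]] by (auto simp: f_def inj_on_def)
        next
          case False
          then have "{f u, f v} \<in> G" using AG[OF ck ck _ fA fA] uv by blast
          then show ?thesis using uv(3) loopless by simp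
        qed
      qed
      show "f ` verts H \<subseteq> V" using fA A(1) ck by blast
      fix e assume e: "e \<in> edges H"
      then obtain u v where uv: "e = {u, v}" "u \<in> verts H" "v \<in> verts H" using E by (meson edgeE subsetD)
      then have "c u \<noteq> c v" using c e by (auto simp: proper_colouring_def)
      then show "f ` e \<in> G" using AG[OF ck ck _ fA fA] uv by simp
    qed
  qed
qed

section \<open>The extremal problem\<close>

lemma finite_ex_log_values:
  "finite {\<Sum>e\<in>edges (complete_graph n). ln (real (card (P e))) | P.
     P \<in> palette_templates n l \<and> sdr_free H n P}" (is "finite ?X")
proof -
  have "?X \<subseteq> (\<lambda>P. \<Sum>e\<in>edges (complete_graph n). ln (real (card (P e)))) ` palette_templates n l" by auto
  moreover have "finite (palette_templates n l)"
    unfolding palette_templates_def complete_graph_def by (intro finite_PiE) (auto intro: finite_all_edges)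
  ultimately show ?thesis using finite_surj by blast
qed

text \<open>With at most \<open>j\<close> monochromatic edges, deleting them and some others would
  leave a graph properly coloured by \<open>c \<circ> f\<close> with \<open>r\<close> colours, which
  is too few unless \<open>r = 1\<close>. In that case every edge of \<open>H\<close> is
  monochromatic, and there are more than \<open>j\<close> of them.\<close>

lemma monochromatic_edges_exceed:
  assumes H: "simple_graph H" and j: "j < card (edges H)"
    and r: "r = max (chi_del H j) 2 - 1" and c: "\<And>i. c i < r"
    and f: "inj_on f (verts H)"
  shows "j < card {e \<in> edges H. is_singleton (c ` f ` e)}" (is "j < card ?S")
proof (rule ccontr)
  assume "\<not> j < card ?S"
  \<comment> \<open>Padded to exactly \<open>j\<close> edges, the size over which
    \<open>chi_del\<close> minimises.\<close>
  then obtain S where S: "?S \<subseteq> S" "S \<subseteq> edges H" "card S = j"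
    using exists_subset_between[of ?S j "edges H"] j finite_edges[OF H] by auto
  have E: "edges H \<subseteq> all_edges (verts H)" using H by (auto simp: simple_graph_def)
  have "proper_colouring (del_edges H S) r (c \<circ> f)"
    unfolding proper_colouring_def
  proof (intro conjI ballI impI)
    fix u v assume "{u, v} \<in> edges (del_edges H S)"
    then have "{u, v} \<in> edges H" "{u, v} \<notin> ?S" using S by (auto simp: del_edges_def)
    then show "(c \<circ> f) u \<noteq> (c \<circ> f) v" by (auto simp: is_singleton_def)
  qed (use c in auto)
  then have "chromatic_number (del_edges H S) \<le> r"
    using chromatic_number_le_iff[OF simple_graph_del_edges[OF H]] by blast
  then have "chi_del H j \<le> r" using chi_del_le[OF H _ S(2,3)] j by simp
  \<comment> \<open>If \<open>chi_del H j\<close> were at least 3, then \<open>r\<close> would equal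
    \<open>chi_del H j - 1\<close>.\<close>
  then have "r = 1" using r by auto
  have "edges H \<subseteq> ?S"
  proof
    fix e assume "e \<in> edges H"
    then obtain u v where "e = {u, v}" using E by (meson edgeE subsetD)
    moreover have "c i = 0" for i using c[of i] \<open>r = 1\<close> by simp
    ultimately show "e \<in> ?S" using \<open>e \<in> edges H\<close> by (auto simp: is_singleton_def)
  qed
  then have "card (edges H) \<le> card ?S" using finite_edges[OF H] by (intro card_mono) auto
  then show False using \<open>\<not> j < card ?S\<close> j by simp
qed

lemma sdr_free_Turan_template:
  assumes H: "simple_graph H" and j: "1 \<le> j" "j < card (edges H)" "j \<le> l"
  shows "\<exists>P\<in>palette_templates n l. sdr_free H n P \<and>
    (pi_del H j * ln (real l) + (1 - pi_del H j) * ln (real j)) * real (n choose 2)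
      \<le> (\<Sum>e\<in>edges (complete_graph n). ln (real (card (P e))))"
proof -
  define r where "r = max (chi_del H j) 2 - 1"
  have r1: "1 \<le> r" by (simp add: r_def)
  obtain c where c: "\<And>i. c i < r"
    "r * card ({e. is_singleton (c ` e)} \<inter> all_edges {1..n}) \<le> n choose 2"
    using colouring_few_monochromatic_edges[OF r1] by blast
  let ?K = "all_edges {1..n}"
  let ?M = "{e. is_singleton (c ` e)}"
  define P where "P = (\<lambda>e\<in>?K. if e \<in> ?M then {1..j} else {1..l})"
  have finK: "finite ?K" by (simp add: finite_all_edges)
  have "P \<in> palette_templates n l"
    using j by (auto simp: palette_templates_def complete_graph_def P_def)
  moreover have "sdr_free H n P"
    unfolding sdr_free_def
  proof (intro allI impI notI)
    fix F assume F: "copy_in H F (complete_graph n)" and "has_sdr (edges F) P"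
    then obtain a where a: "\<forall>e\<in>edges F. a e \<in> P e" "inj_on a (edges F)"
      unfolding has_sdr_def by blast
    obtain f where f: "bij_betw f (verts H) (verts F)" "edges F = (\<lambda>e. f ` e) ` edges H"
      and FK: "edges F \<subseteq> ?K"
      using F unfolding copy_in_def complete_graph_def by auto
    let ?S = "{e \<in> edges H. is_singleton (c ` f ` e)}"
    have inj: "inj_on f (verts H)" using f(1) by (simp add: bij_betw_def)
    have "edges H \<subseteq> Pow (verts H)" using H by (auto simp: simple_graph_def all_edges_def)
    then have "inj_on ((`) f) ?S"
      by (intro inj_on_subset[OF inj_on_image_Pow[OF inj]]) auto
    moreover have "inj_on a ((`) f ` ?S)" using a(2) f(2) by (auto intro: inj_on_subset)
    \<comment> \<open>The representatives give an injection from the monochromatic edges of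
      \<open>H\<close> into \<open>{1..j}\<close>, although there are more than \<open>j\<close>
      such edges.\<close>
    ultimately have "inj_on (a \<circ> (`) f) ?S" by (rule comp_inj_on)
    moreover have "(a \<circ> (`) f) ` ?S \<subseteq> {1..j}"
    proof
      fix x assume "x \<in> (a \<circ> (`) f) ` ?S"
      then obtain e where e: "e \<in> ?S" "x = a (f ` e)" by auto
      then have "f ` e \<in> edges F" using f(2) by auto
      then have "x \<in> P (f ` e)" "f ` e \<in> ?K" using a(1) e(2) FK by auto
      then show "x \<in> {1..j}" using e(1) by (simp add: P_def)
    qed
    ultimately have "card ?S \<le> card {1..j}" by (meson card_inj_on_le finite_atLeastAtMost)
    moreover have "j < card ?S"
      using monochromatic_edges_exceed[OF H j(2) r_def c(1) inj] .
    ultimately show False by simp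
  qed
  moreover have "(\<Sum>e\<in>?K. ln (real (card (P e))))
      = real (card (?K \<inter> ?M)) * ln j + real (card (?K \<inter> - ?M)) * ln l"
  proof -
    have "(\<Sum>e\<in>?K. ln (real (card (P e)))) = (\<Sum>e\<in>?K. if e \<in> ?M then ln (real j) else ln (real l))"
      by (intro sum.cong) (auto simp: P_def)
    then show ?thesis using finK by (simp add: sum.If_cases)
  qed
  moreover have "card (?K \<inter> ?M) + card (?K \<inter> - ?M) = n choose 2"
  proof -
    have "card (?K \<inter> ?M) + card (?K \<inter> - ?M) = card ((?K \<inter> ?M) \<union> (?K \<inter> - ?M))"
      using finK by (intro card_Un_disjoint[symmetric]) auto
    also have "(?K \<inter> ?M) \<union> (?K \<inter> - ?M) = ?K" by blast
    finally show ?thesis by (simp add: card_all_edges)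
  qed
  then have "real (card (?K \<inter> - ?M)) = real (n choose 2) - real (card (?K \<inter> ?M))" by linarith
  moreover have "(pi_del H j * ln l + (1 - pi_del H j) * ln j) * real (n choose 2)
      \<le> real (card (?K \<inter> ?M)) * ln j + (real (n choose 2) - real (card (?K \<inter> ?M))) * ln l"
  proof -
    have "real r * real (card (?K \<inter> ?M)) \<le> real (n choose 2)"
      using c(2) by (metis Int_commute of_nat_mono of_nat_mult)
    then have "real (card (?K \<inter> ?M)) \<le> 1 / r * real (n choose 2)" using r1 by (simp add: field_simps)
    moreover have "0 \<le> ln l - ln j" using j by simp
    ultimately have "real (card (?K \<inter> ?M)) * (ln l - ln j) \<le> 1 / r * real (n choose 2) * (ln l - ln j)"
      by (rule mult_right_mono)
    moreover have "1 / r = 1 - pi_del H j" by (simp add: pi_del_eq r_def)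
    ultimately have "real (card (?K \<inter> ?M)) * (ln l - ln j)
        \<le> (1 - pi_del H j) * real (n choose 2) * (ln l - ln j)" by simp
    then show ?thesis by (simp add: algebra_simps)
  qed
  ultimately show ?thesis by (auto simp: complete_graph_def)
qed

lemma ex_log_ge:
  assumes "simple_graph H" and "1 \<le> j" "j < card (edges H)" "j \<le> l"
  shows "(pi_del H j * ln (real l) + (1 - pi_del H j) * ln (real j)) * real (n choose 2) \<le> ex_log n H l"
proof -
  obtain P where P: "P \<in> palette_templates n l" "sdr_free H n P"
    "(pi_del H j * ln (real l) + (1 - pi_del H j) * ln (real j)) * real (n choose 2)
      \<le> (\<Sum>e\<in>edges (complete_graph n). ln (real (card (P e))))"
    using sdr_free_Turan_template[OF assms] by blast
  moreover have "(\<Sum>e\<in>edges (complete_graph n). ln (real (card (P e)))) \<le> ex_log n H l"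
    unfolding ex_log_def using P finite_ex_log_values[of n l H] by (intro Max_ge) auto
  ultimately show ?thesis by simp
qed

section \<open>Upper bound from the graph of large palettes\<close>

text \<open>The partition template with \<open>j = 1\<close> shows that the set under
  \<open>Max\<close> is nonempty.\<close>

lemma ex_log_attained:
  assumes "simple_graph H" and "2 \<le> card (edges H)" "1 \<le> l"
  obtains P where "P \<in> palette_templates n l" "sdr_free H n P"
    "ex_log n H l = (\<Sum>e\<in>edges (complete_graph n). ln (real (card (P e))))"
proof -
  obtain P where "P \<in> palette_templates n l" "sdr_free H n P"
    using sdr_free_Turan_template[of H 1 l n] assms by auto
  then have "{\<Sum>e\<in>edges (complete_graph n). ln (real (card (P e))) | P.
     P \<in> palette_templates n l \<and> sdr_free H n P} \<noteq> {}" by auto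
  from Max_in[OF finite_ex_log_values this] that show thesis
    unfolding ex_log_def by auto
qed

text \<open>Let \<open>e0\<close> attain \<open>chi_del H 1\<close>. A colouring of
  \<open>H - e0\<close> embeds it into the multipartite graph, where all palettes are large; the
  same vertex map places \<open>e0\<close> on some pair of \<open>K_n\<close>, whose palette is at
  least nonempty. So only one palette of the copy can be small.\<close>

lemma sdr_free_large_palettes:
  assumes H: "simple_graph H" and m: "1 \<le> card (edges H)"
    and P: "P \<in> palette_templates n l" "sdr_free H n P"
    and k: "chi_del H 1 \<le> k"
  shows "\<not> contains_multipartite {e \<in> all_edges {1..n}. card (edges H) \<le> card (P e)} {1..n} k (card (verts H))"
    (is "\<not> contains_multipartite ?G _ _ _")
proof
  assume G: "contains_multipartite ?G {1..n} k (card (verts H))"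
  obtain S where "S \<subseteq> edges H" "card S = 1" "chi_del H 1 = chromatic_number (del_edges H S)"
    using chi_del_attained[OF H m] by blast
  then obtain e0 where e0: "e0 \<in> edges H" "chromatic_number (del_edges H {e0}) \<le> k"
    using k by (auto simp: card_1_singleton_iff)
  let ?H = "del_edges H {e0}"
  have vH: "verts ?H = verts H" by (simp add: del_edges_def)
  obtain c where c: "proper_colouring ?H k c"
    using e0(2) chromatic_number_le_iff[OF simple_graph_del_edges[OF H]] by blast
  have "{x} \<notin> ?G" for x by (simp add: all_edges_def)
  then obtain f where f: "inj_on f (verts H)" "f ` verts H \<subseteq> {1..n}"
    and fG: "\<forall>e\<in>edges ?H. f ` e \<in> ?G"
    using embed_in_multipartite[OF simple_graph_del_edges[OF H] c, of ?G "{1..n}"] G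
    unfolding vH by blast
  define F where "F = (f ` verts H, (\<lambda>e. f ` e) ` edges H)"
  have FK: "edges F \<subseteq> all_edges {1..n}"
  proof
    fix e' assume "e' \<in> edges F"
    then obtain e where e: "e' = f ` e" "e \<in> all_edges (verts H)"
      using H by (auto simp: F_def simple_graph_def)
    have "card (f ` e) = card e"
      using e(2) f(1) by (intro card_image) (auto simp: all_edges_def intro: inj_on_subset)
    then show "e' \<in> all_edges {1..n}" using e f(2) by (auto simp: all_edges_def)
  qed
  have "copy_in H F (complete_graph n)"
    unfolding copy_in_def
  proof (intro conjI exI[of _ f])
    show "bij_betw f (verts H) (verts F)" using f(1) by (simp add: F_def bij_betw_def)
  qed (use f(2) FK in \<open>auto simp: F_def complete_graph_def\<close>)
  moreover have "has_sdr (edges F) P"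
  proof (rule has_sdr_one_small)
    show "finite (edges F)" using finite_edges[OF H] by (simp add: F_def)
    show "f ` e0 \<in> edges F" using e0(1) by (simp add: F_def)
    then show "P (f ` e0) \<noteq> {}"
      using FK P(1) by (auto simp: palette_templates_def complete_graph_def)
    fix e' assume "e' \<in> edges F" "e' \<noteq> f ` e0"
    then obtain e where "e' = f ` e" "e \<in> edges ?H" by (auto simp: F_def del_edges_def)
    then have "card (edges H) \<le> card (P e')" using fG by auto
    moreover have "card (edges F) \<le> card (edges H)"
      using card_image_le[OF finite_edges[OF H]] by (simp add: F_def)
    ultimately show "card (edges F) \<le> card (P e')" by simp
  qed
  ultimately show False using P(2) unfolding sdr_free_def by blast
qed

lemma ex_log_le:
  fixes \<delta> :: real
  assumes H: "simple_graph H" and m: "2 \<le> card (edges H)" "card (edges H) \<le> l" and "0 < \<delta>"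
  shows "\<exists>N. \<forall>n\<ge>N. ex_log n H l \<le>
    (pi_minus H * ln (real l) + (1 - pi_minus H) * ln (real (card (edges H) - 1)) + \<delta>) * real (n choose 2)"
proof -
  define a b where "a = ln (real l)" and "b = ln (real (card (edges H) - 1))"
  have ab: "b \<le> a" using m by (simp add: a_def b_def)
  \<comment> \<open>Adding 1 keeps the denominator positive, and the density error still contributes
    at most \<open>\<delta>\<close> to the weight.\<close>
  define \<epsilon> where "\<epsilon> = \<delta> / (a - b + 1)"
  have "0 < \<epsilon>" using ab \<open>0 < \<delta>\<close> by (simp add: \<epsilon>_def)
  have \<epsilon>: "\<epsilon> * (a - b) \<le> \<delta>" using ab \<open>0 < \<delta>\<close> by (simp add: \<epsilon>_def field_simps)
  define r where "r = max (chi_del H 1) 2 - 1"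
  have \<pi>: "pi_minus H = 1 - 1 / real r" by (simp add: pi_del_eq r_def)
  have "0 < card (verts H)"
  proof (rule ccontr)
    assume "\<not> ?thesis"
    then have "verts H = {}" using H by (simp add: simple_graph_def)
    then have "edges H \<subseteq> {}" using H by (auto simp: simple_graph_def all_edges_def)
    then show False using m by simp
  qed
  moreover have "1 \<le> r" by (simp add: r_def)
  ultimately obtain N where N: "\<And>(V :: nat set) G. finite V \<Longrightarrow> N \<le> card V \<Longrightarrow>
    \<not> contains_multipartite G V (Suc r) (card (verts H)) \<Longrightarrow>
    real (card (G \<inter> all_edges V)) \<le> (pi_minus H + \<epsilon>) * real (card V choose 2)"
    using Erdos_Stone[OF \<open>0 < \<epsilon>\<close>] unfolding \<pi> by metis
  show ?thesis
  proof (intro exI[of _ N] allI impI)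
    fix n assume "N \<le> n"
    obtain P where P: "P \<in> palette_templates n l" "sdr_free H n P"
      and ex: "ex_log n H l = (\<Sum>e\<in>edges (complete_graph n). ln (real (card (P e))))"
      using ex_log_attained[OF H m(1)] m by (metis le_trans one_le_numeral)
    let ?K = "all_edges {1..n}"
    have finK: "finite ?K" by (simp add: finite_all_edges)
    define G where "G = {e \<in> ?K. card (edges H) \<le> card (P e)}"
    \<comment> \<open>\<open>Suc r\<close> is \<open>max (chi_del H 1) 2\<close>, hence at least
      \<open>chi_del H 1\<close>.\<close>
    have "\<not> contains_multipartite G {1..n} (Suc r) (card (verts H))"
      unfolding G_def by (rule sdr_free_large_palettes[OF H _ P]) (use m in \<open>auto simp: r_def\<close>)
    moreover have "G \<inter> ?K = G" by (auto simp: G_def)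
    ultimately have cG: "real (card G) \<le> (pi_minus H + \<epsilon>) * real (n choose 2)"
      using N[of "{1..n}" G] \<open>N \<le> n\<close> by simp
    have "ex_log n H l = (\<Sum>e\<in>?K. ln (real (card (P e))))" using ex by (simp add: complete_graph_def)
    also have "\<dots> \<le> (\<Sum>e\<in>?K. b + (if e \<in> G then a - b else 0))"
    proof (rule sum_mono)
      fix e assume "e \<in> ?K"
      then have Pe: "P e \<subseteq> {1..l}" "P e \<noteq> {}"
        using P(1) by (auto simp: palette_templates_def complete_graph_def)
      then have "0 < card (P e)" "card (P e) \<le> l"
        using card_mono[of "{1..l}" "P e"] finite_subset[of "P e" "{1..l}"] by (auto simp: card_gt_0_iff)
      then show "ln (real (card (P e))) \<le> b + (if e \<in> G then a - b else 0)"
        using \<open>e \<in> ?K\<close> by (auto simp: G_def a_def b_def)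
    qed
    also have "\<dots> = b * real (n choose 2) + real (card G) * (a - b)"
    proof -
      have "?K \<inter> G = G" by (auto simp: G_def)
      then have "(\<Sum>e\<in>?K. if e \<in> G then a - b else 0) = real (card G) * (a - b)"
        using finK by (simp flip: sum.inter_restrict)
      then show ?thesis by (simp add: sum.distrib card_all_edges)
    qed
    also have "\<dots> \<le> b * real (n choose 2) + (pi_minus H + \<epsilon>) * real (n choose 2) * (a - b)"
      using cG ab by (intro add_left_mono mult_right_mono) auto
    also have "\<dots> = (pi_minus H * a + (1 - pi_minus H) * b + \<epsilon> * (a - b)) * real (n choose 2)"
      by (simp add: algebra_simps)
    also have "\<dots> \<le> (pi_minus H * a + (1 - pi_minus H) * b + \<delta>) * real (n choose 2)"
      using \<epsilon> by (intro mult_right_mono) auto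
    finally show "ex_log n H l \<le>
      (pi_minus H * ln (real l) + (1 - pi_minus H) * ln (real (card (edges H) - 1)) + \<delta>) * real (n choose 2)"
      unfolding a_def b_def .
  qed
qed

section \<open>Bounds for the infimum and their asymptotics\<close>

text \<open>The lower bound holds for every \<open>n\<close> and so passes to the infimum. For the
  upper bound, each positive \<open>\<delta>\<close> needs only one sufficiently large
  \<open>n\<close>. Having two vertices in \<open>H\<close> makes every denominator
  positive.\<close>

lemma
  assumes "simple_graph H" and "2 \<le> card (verts H)"
    and "1 \<le> j" "j < card (edges H)" "card (edges H) \<le> l"
  shows sdr_lambda_ge: "pi_del H j * ln (real l) + (1 - pi_del H j) * ln (real j) \<le> sdr_lambda H l"
    and sdr_lambda_le: "sdr_lambda H l
      \<le> pi_minus H * ln (real l) + (1 - pi_minus H) * ln (real (card (edges H) - 1))"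
proof -
  let ?L = "pi_del H j * ln (real l) + (1 - pi_del H j) * ln (real j)"
  let ?U = "pi_minus H * ln (real l) + (1 - pi_minus H) * ln (real (card (edges H) - 1))"
  have pos: "0 < real (n choose 2)" if "n \<in> {card (verts H)..}" for n
    using that assms(2) by simp
  have ge: "?L \<le> ex_log n H l / real (n choose 2)" if "n \<in> {card (verts H)..}" for n
    using ex_log_ge[of H j l n] assms pos[OF that] by (simp add: field_simps)
  then show "?L \<le> sdr_lambda H l" unfolding sdr_lambda_def by (intro cINF_greatest) auto
  show "sdr_lambda H l \<le> ?U"
  proof (rule field_le_epsilon)
    fix \<delta> :: real assume "0 < \<delta>"
    then obtain N where N: "\<And>n. N \<le> n \<Longrightarrow> ex_log n H l \<le> (?U + \<delta>) * real (n choose 2)"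
      using ex_log_le[of H l \<delta>] assms by auto
    define n where "n = max N (card (verts H))"
    have n: "N \<le> n" "n \<in> {card (verts H)..}" by (auto simp: n_def)
    have "sdr_lambda H l \<le> ex_log n H l / real (n choose 2)"
      \<comment> \<open>An infimum over reals lies below its values only if they are bounded below;
        \<open>?L\<close> serves as such a bound.\<close>
      unfolding sdr_lambda_def using ge n(2) by (intro cINF_lower bdd_belowI2[of _ ?L]) auto
    also have "\<dots> \<le> ?U + \<delta>" using N[OF n(1)] pos[OF n(2)] by (simp add: field_simps)
    finally show "sdr_lambda H l \<le> ?U + \<delta>" .
  qed
qed

text \<open>From chromatic number 3 on, the density is at least 1/2, so it vanishes only when
  deleting some edge leaves chromatic number at most 2.\<close>

lemma pi_minus_eq_0_iff:
  assumes "simple_graph H" and "1 \<le> card (edges H)"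
  shows "pi_minus H = 0 \<longleftrightarrow> (\<exists>e\<in>edges H. bipartite (del_edges H {e}))"
proof -
  have "pi_minus H = 0 \<longleftrightarrow> chi_del H 1 \<le> 2" by (auto simp: pi_del_def)
  also have "\<dots> \<longleftrightarrow> (\<exists>e\<in>edges H. chromatic_number (del_edges H {e}) \<le> 2)"
  proof
    assume "chi_del H 1 \<le> 2"
    then obtain S where "S \<subseteq> edges H" "card S = 1" "chromatic_number (del_edges H S) \<le> 2"
      using chi_del_attained[OF assms] by auto
    then show "\<exists>e\<in>edges H. chromatic_number (del_edges H {e}) \<le> 2"
      by (auto simp: card_1_singleton_iff)
  next
    assume "\<exists>e\<in>edges H. chromatic_number (del_edges H {e}) \<le> 2"
    then obtain e where e: "e \<in> edges H" "chromatic_number (del_edges H {e}) \<le> 2" by blast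
    then show "chi_del H 1 \<le> 2" using chi_del_le[OF assms, of "{e}"] by simp
  qed
  finally show ?thesis
    by (simp add: bipartite_iff_chromatic_number simple_graph_del_edges[OF assms(1)])
qed

lemma const_over_ln_tendsto_0: "(\<lambda>l. c / ln (real l)) \<longlonglongrightarrow> 0"
proof -
  have "filterlim (\<lambda>l. ln (real l)) at_top sequentially"
    by (rule filterlim_compose[OF ln_at_top filterlim_real_sequentially])
  then show ?thesis
    by (intro tendsto_divide_0[OF tendsto_const] filterlim_at_top_imp_at_infinity)
qed

text \<open>In the lower bound with \<open>j = 1\<close> the second term vanishes, leaving exactly
  \<open>pi_minus H * ln l\<close>; the upper bound differs from this by a constant, which
  disappears on division by \<open>ln l\<close>.\<close>

lemma sdr_lambda_limit:
  assumes "simple_graph H" and "2 \<le> card (verts H)" and "2 \<le> card (edges H)"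
  shows "(\<lambda>l. sdr_lambda H l / ln (real l)) \<longlonglongrightarrow> pi_minus H"
proof (rule tendsto_sandwich)
  let ?b = "(1 - pi_minus H) * ln (real (card (edges H) - 1))"
  have ev: "eventually (\<lambda>l. card (edges H) \<le> l) sequentially" by (rule eventually_ge_at_top)
  show "eventually (\<lambda>l. pi_minus H \<le> sdr_lambda H l / ln (real l)) sequentially"
    using ev
  proof eventually_elim
    case (elim l)
    then show ?case
      using sdr_lambda_ge[of H 1 l] assms by (simp add: pos_le_divide_eq)
  qed
  show "eventually (\<lambda>l. sdr_lambda H l / ln (real l) \<le> pi_minus H + ?b / ln (real l)) sequentially"
    using ev
  proof eventually_elim
    case (elim l)
    then have "0 < ln (real l)" using assms by simp
    then show ?case
      using sdr_lambda_le[of H 1 l] assms elim by (simp add: divide_le_eq distrib_right)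
  qed
  show "(\<lambda>l. pi_minus H + ?b / ln (real l)) \<longlonglongrightarrow> pi_minus H"
    using tendsto_add[OF tendsto_const const_over_ln_tendsto_0, of "pi_minus H" ?b] by simp
qed simp

theorem theorem1p5:
  fixes H :: "'a graph"
  assumes "simple_graph H"
    and "no_isolated_verts H"
    and "non_matching H"
    and "card (edges H) \<ge> 3"
  shows "(\<forall>l \<ge> card (edges H).
            sdr_lambda H l \<ge>
              (MAX j\<in>{1..card (edges H) - 1}.
                 pi_del H j * ln (real l) + (1 - pi_del H j) * ln (real j))
          \<and> sdr_lambda H l \<le>
              pi_minus H * ln (real l) + (1 - pi_minus H) * ln (real (card (edges H) - 1)))
       \<and> ((\<lambda>l. sdr_lambda H l / ln (real l)) \<longlonglongrightarrow> pi_minus H)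
       \<and> ((\<forall>l \<ge> card (edges H). sdr_lambda H l = ln (real (card (edges H) - 1)))
          \<longleftrightarrow> (\<exists>e\<in>edges H. bipartite (del_edges H {e})))"
proof -
  let ?m = "card (edges H)"
  have "edges H \<noteq> {}" using assms(4) by auto
  then obtain e where "e \<in> all_edges (verts H)" using assms(1) by (auto simp: simple_graph_def)
  then have v: "2 \<le> card (verts H)"
    using assms(1) card_mono[of "verts H" e] by (auto simp: all_edges_def simple_graph_def)
  have lower: "pi_del H j * ln (real l) + (1 - pi_del H j) * ln (real j) \<le> sdr_lambda H l"
    if "j \<in> {1..?m - 1}" "?m \<le> l" for j l
    using that assms(4) by (intro sdr_lambda_ge[OF assms(1) v]) auto
  have upper: "sdr_lambda H l \<le> pi_minus H * ln (real l) + (1 - pi_minus H) * ln (real (?m - 1))"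
    if "?m \<le> l" for l
    using that assms(4) by (intro sdr_lambda_le[OF assms(1) v, of 1]) auto
  have limit: "(\<lambda>l. sdr_lambda H l / ln (real l)) \<longlonglongrightarrow> pi_minus H"
    using sdr_lambda_limit[OF assms(1) v] assms(4) by simp
  \<comment> \<open>A value constant in \<open>l\<close> has limit 0 after division by
    \<open>ln l\<close>, and that limit is \<open>pi_minus H\<close>. Conversely, when
    \<open>pi_minus H = 0\<close> the upper bound meets the lower bound for
    \<open>j = ?m - 1\<close>.\<close>
  have "(\<forall>l\<ge>?m. sdr_lambda H l = ln (real (?m - 1))) \<longleftrightarrow> pi_minus H = 0"
  proof
    assume eq: "\<forall>l\<ge>?m. sdr_lambda H l = ln (real (?m - 1))"
    have "eventually (\<lambda>l. ln (real (?m - 1)) / ln (real l) = sdr_lambda H l / ln (real l)) sequentially"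
      using eventually_ge_at_top[of ?m] by eventually_elim (use eq in simp)
    then have "(\<lambda>l. sdr_lambda H l / ln (real l)) \<longlonglongrightarrow> 0"
      by (rule Lim_transform_eventually[OF const_over_ln_tendsto_0])
    then show "pi_minus H = 0" using LIMSEQ_unique limit by blast
  next
    assume pi0: "pi_minus H = 0"
    show "\<forall>l\<ge>?m. sdr_lambda H l = ln (real (?m - 1))"
    proof (intro allI impI antisym)
      fix l assume l: "?m \<le> l"
      show "sdr_lambda H l \<le> ln (real (?m - 1))" using upper[OF l] pi0 by simp
      let ?p = "pi_del H (?m - 1)"
      \<comment> \<open>The lower bound at \<open>j = ?m - 1\<close> is \<open>ln (?m - 1)\<close>
        plus this term, whatever the value of \<open>?p \<ge> 0\<close>.\<close>
      have "0 \<le> ?p * (ln (real l) - ln (real (?m - 1)))"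
        using l assms(4) pi_del_nonneg[of H "?m - 1"] by (intro mult_nonneg_nonneg) auto
      then have "ln (real (?m - 1)) \<le> ?p * ln (real l) + (1 - ?p) * ln (real (?m - 1))"
        by (simp add: algebra_simps)
      also have "\<dots> \<le> sdr_lambda H l" using assms(4) l by (intro lower) auto
      finally show "ln (real (?m - 1)) \<le> sdr_lambda H l" .
    qed
  qed
  also have "\<dots> \<longleftrightarrow> (\<exists>e\<in>edges H. bipartite (del_edges H {e}))"
    using pi_minus_eq_0_iff[OF assms(1)] assms(4) by simp
  finally have iff: "(\<forall>l\<ge>?m. sdr_lambda H l = ln (real (?m - 1)))
      \<longleftrightarrow> (\<exists>e\<in>edges H. bipartite (del_edges H {e}))" .
  have "(MAX j\<in>{1..?m - 1}. pi_del H j * ln (real l) + (1 - pi_del H j) * ln (real j)) \<le> sdr_lambda H l"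
    if "?m \<le> l" for l
    using lower[OF _ that] assms(4) by (intro Max.boundedI) auto
  then show ?thesis using upper limit iff by blast
qed

end
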